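(* Let $P \in [0,1]^{n\times n}$ be a stochastic matrix with rational entries, let $r \in \mathbb{Z}^n$, and let $u \in \mathbb{R}^n$ be a bias vector of $(r,P)$, i.e. there is $\chi\in\mathbb{R}^n$ with $P\chi = \chi$ and $Pu = \chi + u - r$. Let $C_1,\dots,C_p$ be the recurrent classes of the Markov chain with transition matrix $P$ and $\pi^{(\ell)}$ the stationary distribution on $C_\ell$. Then: (i) if for every $\ell \in [p]$ there exists $i_\ell \in C_\ell$ with $u_{i_\ell}=0$, then $\|u\|_\infty \le 2\|r\|_\infty\, n \min\{D, M^{n-1}\}$; (ii) if $\sum_{i\in C_\ell} u_i \pi^{(\ell)}_i = 0$ for all $\ell\in[p]$, then $\|u\|_\infty \le 4\|r\|_\infty\, n\min\{D,M^{n-1}\}$.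
   Context: For each $i$, $M_i$ is the lowest common denominator of the entries of the $i$-th row of $P$; $M$ is the lowest common denominator of all entries of $P$; $D \coloneqq M_1\cdots M_n$. $\|\cdot\|_\infty$ is the supremum norm. *)

theory Defs
  imports "HOL-Analysis.Analysis"
begin

definition stochastic :: "real^'n^'n \<Rightarrow> bool" where
  "stochastic P \<longleftrightarrow> (\<forall>i j. P $ i $ j \<in> {0..1}) \<and> (\<forall>i. (\<Sum>j\<in>UNIV. P $ i $ j) = 1)"

definition lowest_common_denominator :: "real set \<Rightarrow> nat" where
  "lowest_common_denominator S = (LEAST m. 0 < m \<and> (\<forall>x\<in>S. real m * x \<in> \<int>))"

definition row_denominator :: "real^'n^'n \<Rightarrow> 'n \<Rightarrow> nat" where
  "row_denominator P i = lowest_common_denominator {P $ i $ j | j. True}"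

definition matrix_denominator :: "real^'n^'n \<Rightarrow> nat" where
  "matrix_denominator P = lowest_common_denominator {P $ i $ j | i j. True}"

definition bias_vector :: "real^'n \<Rightarrow> real^'n^'n \<Rightarrow> real^'n \<Rightarrow> bool" where
  "bias_vector r P u \<longleftrightarrow> (\<exists>g. P *v g = g \<and> P *v u = g + u - r)"

definition accessible :: "real^'n^'n \<Rightarrow> ('n \<times> 'n) set" where
  "accessible P = {(i, j). 0 < P $ i $ j}\<^sup>*"

definition communicating_class :: "real^'n^'n \<Rightarrow> 'n \<Rightarrow> 'n set" where
  "communicating_class P i = {j. (i, j) \<in> accessible P \<and> (j, i) \<in> accessible P}"

text \<open>\<open>first_passage P j k i\<close> is the probability that the chain started in \<open>i\<close> visits \<open>j\<close>
  at time \<open>k + 1\<close>, and at none of the times \<open>1, \<dots>, k\<close>.\<close>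

primrec first_passage :: "real^'n^'n \<Rightarrow> 'n \<Rightarrow> nat \<Rightarrow> 'n \<Rightarrow> real" where
  "first_passage P j 0 i = P $ i $ j"
| "first_passage P j (Suc k) i = (\<Sum>l\<in>UNIV - {j}. P $ i $ l * first_passage P j k l)"

definition recurrent_state :: "real^'n^'n \<Rightarrow> 'n \<Rightarrow> bool" where
  "recurrent_state P i \<longleftrightarrow> (\<lambda>k. first_passage P i k i) sums 1"

definition recurrent_classes :: "real^'n^'n \<Rightarrow> 'n set set" where
  "recurrent_classes P =
    {C. (\<exists>i. C = communicating_class P i) \<and> (\<forall>j\<in>C. recurrent_state P j)}"

text \<open>A distribution on the whole state space whose support lies in \<open>C\<close>; it is unique when
  \<open>C\<close> is a recurrent class.\<close>

definition stationary_distribution_on :: "real^'n^'n \<Rightarrow> 'n set \<Rightarrow> real^'n \<Rightarrow> bool" where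
  "stationary_distribution_on P C d \<longleftrightarrow>
    (\<forall>i. 0 \<le> d $ i) \<and> (\<forall>i. i \<notin> C \<longrightarrow> d $ i = 0) \<and> (\<Sum>i\<in>UNIV. d $ i) = 1 \<and> d v* P = d"

end

theory Submission
  imports Defs
begin

text \<open>For a set \<open>Z\<close> of states reachable from everywhere, let \<open>A\<close> be \<open>I - P\<close> with the rows in \<open>Z\<close>
  replaced by rows of the identity. By the maximum principle \<open>A\<close> has a nonnegative inverse \<open>G\<close>
  with \<open>1 \<le> G\<^sub>j\<^sub>j\<close> and \<open>G\<^sub>i\<^sub>j \<le> G\<^sub>j\<^sub>j\<close>. Cramer's rule says that adding \<open>j\<close> to \<open>Z\<close> multiplies \<open>det A\<close> by
  \<open>G\<^sub>j\<^sub>j\<close>, so \<open>0 < det A \<le> 1\<close> and \<open>G\<^sub>i\<^sub>j \<le> 1 / det A\<close>. Clearing denominators row by row shows that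
  \<open>det A\<close> is a positive multiple of \<open>1 / (\<Prod>i\<notin>Z. M\<^sub>i)\<close>; this bounds the expected hitting times
  \<open>y\<close> of \<open>Z\<close> by \<open>n min {D, M^(n-1)}\<close>. Since \<open>|\<chi>| \<le> \<parallel>r\<parallel>\<close>, the function \<open>u - 2\<parallel>r\<parallel> y\<close> is
  subharmonic off \<open>Z\<close>, and the maximum principle bounds \<open>u\<close> by \<open>2\<parallel>r\<parallel> y\<close> plus its values on \<open>Z\<close>.
  For (i) take for \<open>Z\<close> the zeros of \<open>u\<close>. For (ii) the same bound inside a closed class
  controls the oscillation of \<open>u\<close> there, hence its values, as its mean vanishes.\<close>

section \<open>Maximum principle\<close>

definition reachable_from_all :: "real^'n^'n \<Rightarrow> 'n set \<Rightarrow> bool" where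
  "reachable_from_all P Z \<longleftrightarrow> (\<forall>i. \<exists>z\<in>Z. (i, z) \<in> accessible P)"

lemma reachable_from_all_mono:
  "reachable_from_all P Z \<Longrightarrow> Z \<subseteq> Z' \<Longrightarrow> reachable_from_all P Z'"
  unfolding reachable_from_all_def by blast

lemma stochastic_nonneg: "stochastic P \<Longrightarrow> 0 \<le> P $ i $ j"
  by (simp add: stochastic_def)

lemma stochastic_row_sum: "stochastic P \<Longrightarrow> (\<Sum>j\<in>UNIV. P $ i $ j) = 1"
  by (simp add: stochastic_def)

lemma matrix_vector_component: "(P *v x) $ i = (\<Sum>j\<in>UNIV. P $ i $ j * x $ j)"
  for P :: "real^'n^'m"
  by (simp add: matrix_vector_mult_def)

lemma stochastic_mean_le:
  assumes "stochastic P" and "\<And>l. 0 < P $ k $ l \<Longrightarrow> x $ l \<le> m"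
  shows "(P *v x) $ k \<le> m"
proof -
  have "(P *v x) $ k \<le> (\<Sum>j\<in>UNIV. P $ k $ j * m)"
    unfolding matrix_vector_component
  proof (rule sum_mono)
    fix l
    show "P $ k $ l * x $ l \<le> P $ k $ l * m"
      using assms(2)[of l] stochastic_nonneg[OF assms(1), of k l]
      by (cases "P $ k $ l = 0") (auto intro: mult_left_mono)
  qed
  also have "\<dots> = m"
    by (simp add: sum_distrib_right[symmetric] stochastic_row_sum[OF assms(1)])
  finally show ?thesis .
qed

text \<open>The gaps \<open>m - x $ l\<close>, weighted by row \<open>k\<close>, are nonnegative and
  sum to at most 0, so every gap of positive weight is 0.\<close>

lemma stochastic_mean_eq_max:
  assumes P: "stochastic P" and le: "\<And>l. x $ l \<le> m" and ge: "m \<le> (P *v x) $ k"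
    and pos: "0 < P $ k $ l"
  shows "x $ l = m"
proof -
  have nn: "\<And>j. 0 \<le> P $ k $ j * (m - x $ j)"
    using stochastic_nonneg[OF P] le by simp
  have "(\<Sum>j\<in>UNIV. P $ k $ j * (m - x $ j)) = m - (P *v x) $ k"
    by (simp add: right_diff_distrib sum_subtractf sum_distrib_right[symmetric]
        stochastic_row_sum[OF P] matrix_vector_component)
  also have "\<dots> \<le> 0" using ge by simp
  finally have "(\<Sum>j\<in>UNIV. P $ k $ j * (m - x $ j)) = 0"
    using nn by (meson order_antisym sum_nonneg)
  then have "P $ k $ l * (m - x $ l) = 0"
    using nn by (simp add: sum_nonneg_eq_0_iff)
  then show ?thesis using pos by simp
qed

lemma vec_attains_max:
  fixes x :: "real^'n"
  assumes "T \<noteq> {}"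
  obtains m where "m \<in> T" "\<And>l. l \<in> T \<Longrightarrow> x $ l \<le> x $ m"
proof -
  have *: "Max ((\<lambda>l. x $ l) ` T) \<in> (\<lambda>l. x $ l) ` T"
    using assms by (intro Max_in) auto
  then obtain m where "m \<in> T" "Max ((\<lambda>l. x $ l) ` T) = x $ m" by auto
  then show ?thesis
    using that[of m] by (metis Max_ge finite finite_imageI imageI)
qed

lemma maximum_principle:
  assumes P: "stochastic P" and Z: "reachable_from_all P Z"
    and sub: "\<And>k. k \<notin> Z \<Longrightarrow> x $ k \<le> (P *v x) $ k"
  shows "\<exists>z\<in>Z. x $ i \<le> x $ z"
proof -
  obtain m where m: "\<And>l. x $ l \<le> x $ m"
    using vec_attains_max[of UNIV x] by auto
  obtain z where z: "z \<in> Z" "(m, z) \<in> accessible P"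
    using Z unfolding reachable_from_all_def by blast
  \<comment> \<open>The maximal value spreads along every path from \<open>m\<close> until the path
    first meets \<open>Z\<close>. The second disjunct records that first meeting, since nothing is
    known beyond it.\<close>
  have "x $ k = x $ m \<or> (\<exists>z\<in>Z. x $ z = x $ m)" if "(m, k) \<in> accessible P" for k
    using that unfolding accessible_def
  proof (induction rule: rtrancl_induct)
    case (step k l)
    show ?case
    proof (cases "x $ k = x $ m \<and> k \<notin> Z")
      case True
      then show ?thesis
        using stochastic_mean_eq_max[OF P m, of k l] sub[of k] step by auto
    qed (use step in auto)
  qed simp
  then show ?thesis using z m by metis
qed

section \<open>Laplacian with absorbing states\<close>

definition killed_laplacian :: "real^'n^'n \<Rightarrow> 'n set \<Rightarrow> real^'n^'n" where
  "killed_laplacian P Z = (\<chi> i. if i \<in> Z then axis i 1 else axis i 1 - P $ i)"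

lemma killed_laplacian_mult:
  "(killed_laplacian P Z *v x) $ i = (if i \<in> Z then x $ i else x $ i - (P *v x) $ i)"
  by (simp add: killed_laplacian_def matrix_vector_component axis_def left_diff_distrib
      sum_subtractf if_distrib[where f="\<lambda>a. a * _"] cong: if_cong)

lemma killed_laplacian_nonneg:
  assumes P: "stochastic P" and Z: "reachable_from_all P Z"
    and nn: "\<And>i. 0 \<le> (killed_laplacian P Z *v x) $ i"
  shows "0 \<le> x $ i"
proof -
  have "\<exists>z\<in>Z. (- x) $ i \<le> (- x) $ z"
  proof (rule maximum_principle[OF P Z])
    fix k assume "k \<notin> Z"
    then show "(- x) $ k \<le> (P *v (- x)) $ k"
      using nn[of k] by (simp add: killed_laplacian_mult vec.neg)
  qed
  then obtain z where "z \<in> Z" "x $ z \<le> x $ i" by auto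
  then show ?thesis using nn[of z] by (simp add: killed_laplacian_mult)
qed

lemma killed_laplacian_inverse:
  assumes P: "stochastic P" and Z: "reachable_from_all P Z"
  obtains G where "killed_laplacian P Z ** G = mat 1" "G ** killed_laplacian P Z = mat 1"
proof -
  let ?A = "killed_laplacian P Z"
  have "\<forall>x. ?A *v x = 0 \<longrightarrow> x = 0"
  proof (intro allI impI)
    fix x assume x: "?A *v x = 0"
    then have "?A *v (- x) = 0" by (simp add: vec.neg)
    then have "0 \<le> x $ i" "0 \<le> (- x) $ i" for i
      using x killed_laplacian_nonneg[OF P Z, of x] killed_laplacian_nonneg[OF P Z, of "- x"]
      by simp_all
    then show "x = 0" by (simp add: vec_eq_iff order_antisym)
  qed
  then obtain G where "G ** ?A = mat 1"
    using matrix_left_invertible_ker[of ?A] by auto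
  then show ?thesis
    using that matrix_left_right_inverse by blast
qed

text \<open>For j outside \<open>Z\<close>, \<open>G $ i $ j\<close> is the expected number of
  visits to j from i before absorption in \<open>Z\<close>; for j in \<open>Z\<close> it is the
  probability that \<open>Z\<close> is first hit at j.\<close>

lemma green_matrix_column:
  assumes P: "stochastic P" and Z: "reachable_from_all P Z"
    and AG: "killed_laplacian P Z ** G = mat 1"
  shows green_matrix_diag_ge_1: "1 \<le> G $ j $ j"
    and green_matrix_le_diag: "G $ i $ j \<le> G $ j $ j"
proof -
  let ?g = "column j G"
  have "killed_laplacian P Z *v ?g = column j (killed_laplacian P Z ** G)"
    by (simp add: vec_eq_iff matrix_vector_mult_def matrix_matrix_mult_def column_def)
  then have col: "killed_laplacian P Z *v ?g = axis j 1"
    by (simp add: AG vec_eq_iff column_def mat_def axis_def)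
  have nn: "0 \<le> ?g $ i" for i
    using killed_laplacian_nonneg[OF P Z, of ?g i] col by (simp add: axis_def)
  have eq: "(if i \<in> Z then ?g $ i else ?g $ i - (P *v ?g) $ i) = axis j 1 $ i" for i
    using col killed_laplacian_mult by metis
  have "0 \<le> (P *v ?g) $ j"
    unfolding matrix_vector_component
    by (intro sum_nonneg mult_nonneg_nonneg stochastic_nonneg P nn)
  then show "1 \<le> G $ j $ j"
    using eq[of j] by (simp add: column_def split: if_splits)
  \<comment> \<open>Column j is harmonic off \<open>insert j Z\<close> and vanishes on
    \<open>Z\<close> except possibly at j, so its maximum sits at j.\<close>
  have "\<exists>z\<in>insert j Z. ?g $ i \<le> ?g $ z"
  proof (rule maximum_principle[OF P reachable_from_all_mono[OF Z]])
    fix k assume "k \<notin> insert j Z"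
    then show "?g $ k \<le> (P *v ?g) $ k"
      using eq[of k] by (simp add: axis_def)
  qed auto
  then obtain z where "z \<in> insert j Z" "?g $ i \<le> ?g $ z" by blast
  moreover have "?g $ z \<le> ?g $ j" if "z \<in> Z" "z \<noteq> j"
    using eq[of z] nn[of j] that by (simp add: axis_def)
  ultimately have "?g $ i \<le> ?g $ j" by force
  then show "G $ i $ j \<le> G $ j $ j" by (simp add: column_def)
qed

text \<open>Row j of \<open>G\<close> combines the rows of the Laplacian to the unit row at j, which
  is exactly the row that absorbing j puts in place of row j. This includes j already in
  \<open>Z\<close>.\<close>

lemma det_killed_laplacian_insert:
  assumes "G ** killed_laplacian P Z = mat 1"
  shows "det (killed_laplacian P (insert j Z)) = G $ j $ j * det (killed_laplacian P Z)"
proof -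
  let ?A = "killed_laplacian P Z"
  have "(\<Sum>i\<in>UNIV. G $ j $ i *s row i ?A) = row j (G ** ?A)"
    by (simp add: vec_eq_iff row_def matrix_matrix_mult_def sum_component)
  then have "(\<Sum>i\<in>UNIV. G $ j $ i *s row i ?A) = axis j 1"
    by (simp add: assms vec_eq_iff row_def mat_def axis_def)
  then have "(\<chi> i. if i = j then \<Sum>i\<in>UNIV. G $ j $ i *s row i ?A else row i ?A)
      = killed_laplacian P (insert j Z)"
    by (simp add: vec_eq_iff killed_laplacian_def row_def)
  then show ?thesis using cramer_lemma_transpose[of j "G $ j" ?A] by simp
qed

text \<open>With every state absorbed the matrix is the identity; releasing a state j divides the
  determinant by \<open>G $ j $ j\<close>, which is at least 1.\<close>

lemma det_killed_laplacian_bounds: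
  assumes P: "stochastic P" and "reachable_from_all P Z"
  shows "0 < det (killed_laplacian P Z) \<and> det (killed_laplacian P Z) \<le> 1"
  using assms(2)
proof (induction "card (- Z)" arbitrary: Z)
  case 0
  then have "Z = UNIV" by auto
  then have "killed_laplacian P Z = mat 1"
    by (simp add: killed_laplacian_def vec_eq_iff mat_def axis_def)
  then show ?case by simp
next
  case (Suc n)
  then have "- Z \<noteq> {}" by (metis card.empty nat.distinct(1))
  then obtain j where j: "j \<notin> Z" by blast
  have ins: "reachable_from_all P (insert j Z)"
    using Suc.prems reachable_from_all_mono by blast
  have "- insert j Z = - Z - {j}" by auto
  then have "n = card (- insert j Z)"
    using Suc.hyps(2) j by (simp add: card_Diff_singleton)
  then have IH: "0 < det (killed_laplacian P (insert j Z))"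
      "det (killed_laplacian P (insert j Z)) \<le> 1"
    using Suc.hyps(1) ins by blast+
  obtain G where G: "killed_laplacian P Z ** G = mat 1" "G ** killed_laplacian P Z = mat 1"
    using killed_laplacian_inverse[OF P Suc.prems] by blast
  have ge1: "1 \<le> G $ j $ j" using green_matrix_diag_ge_1[OF P Suc.prems G(1)] .
  have eq: "det (killed_laplacian P (insert j Z)) = G $ j $ j * det (killed_laplacian P Z)"
    using det_killed_laplacian_insert[OF G(2)] .
  then have pos: "0 < det (killed_laplacian P Z)"
    using IH(1) ge1 by (simp add: zero_less_mult_iff)
  then have "det (killed_laplacian P Z) \<le> G $ j $ j * det (killed_laplacian P Z)"
    using ge1 by simp
  then show ?case using pos eq IH(2) by linarith
qed

section \<open>Denominators\<close>

lemma det_in_Ints: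
  fixes A :: "real^'n^'n"
  assumes "\<And>i j. A $ i $ j \<in> \<int>"
  shows "det A \<in> \<int>"
  unfolding det_def using assms by (intro Ints_sum Ints_mult Ints_prod) auto

lemma pos_Ints_ge_1: "x \<in> \<int> \<Longrightarrow> 0 < x \<Longrightarrow> 1 \<le> x" for x :: real
  by (auto elim!: Ints_cases)

lemma common_denominator_exists:
  fixes S :: "real set"
  assumes "finite S" "S \<subseteq> \<rat>"
  shows "\<exists>m::nat. 0 < m \<and> (\<forall>x\<in>S. real m * x \<in> \<int>)"
  using assms
proof (induction S rule: finite_induct)
  case (insert x S)
  then obtain m :: nat where m: "0 < m" "\<forall>x\<in>S. real m * x \<in> \<int>" by auto
  obtain a b where ab: "x = real_of_int a / real b" "b \<noteq> (0::nat)"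
    using insert.prems unfolding Rats_eq_int_div_nat by auto
  have "real (m * b) * x \<in> \<int>" using ab by simp
  moreover have "real (m * b) * y \<in> \<int>" if "y \<in> S" for y
    using Ints_mult[of "real b" "real m * y"] m(2) that by (simp add: mult_ac)
  ultimately show ?case
    using m(1) ab(2) by (intro exI[of _ "m * b"]) auto
qed auto

lemma lowest_common_denominator:
  fixes S :: "real set"
  assumes "finite S" "S \<subseteq> \<rat>"
  shows "0 < lowest_common_denominator S"
    and "x \<in> S \<Longrightarrow> real (lowest_common_denominator S) * x \<in> \<int>"
  using LeastI_ex[OF common_denominator_exists[OF assms]]
  unfolding lowest_common_denominator_def by blast+

lemma lowest_common_denominator_mono:
  fixes S T :: "real set"
  assumes "finite T" "T \<subseteq> \<rat>" "S \<subseteq> T"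
  shows "lowest_common_denominator S \<le> lowest_common_denominator T"
  unfolding lowest_common_denominator_def[of S]
  by (rule Least_le) (use lowest_common_denominator[OF assms(1,2)] assms(3) in blast)

lemma row_denominator:
  fixes P :: "real^'n^'n"
  assumes "\<forall>i j. P $ i $ j \<in> \<rat>"
  shows row_denominator_pos: "0 < row_denominator P i"
    and row_denominator_mult: "real (row_denominator P i) * P $ i $ j \<in> \<int>"
    and row_denominator_le_matrix_denominator: "row_denominator P i \<le> matrix_denominator P"
proof -
  have fin: "finite {P $ i $ j | j. True}" for i
    by (simp add: full_SetCompr_eq)
  have rat: "{P $ i $ j | j. True} \<subseteq> \<rat>" for i using assms by auto
  show "0 < row_denominator P i" "real (row_denominator P i) * P $ i $ j \<in> \<int>"
    unfolding row_denominator_def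
    by (rule lowest_common_denominator[OF fin rat]; blast)+
  have "finite {P $ i $ j | i j. True}"
    by (rule finite_subset[of _ "(\<lambda>(i, j). P $ i $ j) ` UNIV"]) auto
  then show "row_denominator P i \<le> matrix_denominator P"
    unfolding row_denominator_def matrix_denominator_def
    by (rule lowest_common_denominator_mono) (use assms in auto)
qed

definition denominator_bound :: "real^'n^'n \<Rightarrow> nat" where
  "denominator_bound P =
    min (\<Prod>i\<in>UNIV. row_denominator P i) (matrix_denominator P ^ (CARD('n) - 1))"

lemma inverse_det_killed_laplacian_le:
  fixes P :: "real^'n^'n"
  assumes P: "stochastic P" and rat: "\<forall>i j. P $ i $ j \<in> \<rat>" and Z: "reachable_from_all P Z"
  shows "1 / det (killed_laplacian P Z) \<le> real (denominator_bound P)"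
proof -
  let ?A = "killed_laplacian P Z"
  \<comment> \<open>Rows in \<open>Z\<close> are already integral. The scaled determinant is then a
    positive integer, hence at least 1.\<close>
  let ?c = "\<lambda>i. if i \<in> Z then 1 else row_denominator P i"
  have "det (\<chi> i. real (?c i) *s ?A $ i) = (\<Prod>i\<in>UNIV. real (?c i)) * det ?A"
    using det_rows_mul[of "\<lambda>i. real (?c i)" "\<lambda>i. ?A $ i"] by simp
  moreover have "det (\<chi> i. real (?c i) *s ?A $ i) \<in> \<int>"
    using row_denominator_mult[OF rat]
    by (intro det_in_Ints) (auto simp: killed_laplacian_def axis_def right_diff_distrib)
  ultimately have "real (\<Prod>i\<in>UNIV. ?c i) * det ?A \<in> \<int>" by simp
  moreover have cpos: "1 \<le> ?c i" for i
    using row_denominator_pos[OF rat] by (simp add: Suc_leI)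
  then have "0 < (\<Prod>i\<in>UNIV. ?c i)"
    by (intro prod_pos) (metis less_le_trans zero_less_one)
  moreover have det: "0 < det ?A" using det_killed_laplacian_bounds[OF P Z] by simp
  ultimately have "1 \<le> real (\<Prod>i\<in>UNIV. ?c i) * det ?A"
    by (intro pos_Ints_ge_1 mult_pos_pos) (simp_all only: of_nat_0_less_iff)
  then have "1 / det ?A \<le> real (\<Prod>i\<in>UNIV. ?c i)"
    using det by (simp add: divide_le_eq)
  also have "(\<Prod>i\<in>UNIV. ?c i) \<le> denominator_bound P"
    unfolding denominator_bound_def
  proof (rule min.boundedI)
    show "(\<Prod>i\<in>UNIV. ?c i) \<le> (\<Prod>i\<in>UNIV. row_denominator P i)"
      using row_denominator_pos[OF rat] by (intro prod_mono) (auto simp: Suc_leI)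
    let ?M = "matrix_denominator P"
    have "(\<Prod>i\<in>UNIV. ?c i) = (\<Prod>i\<in>-Z. row_denominator P i)"
      by (intro prod.mono_neutral_cong_right) auto
    also have "\<dots> \<le> (\<Prod>i\<in>-Z. ?M)"
      using row_denominator_le_matrix_denominator[OF rat] by (intro prod_mono) auto
    also have "\<dots> = ?M ^ card (- Z)" by simp
    also have "\<dots> \<le> ?M ^ (CARD('n) - 1)"
    proof (rule power_increasing)
      \<comment> \<open>Reachability forces \<open>Z\<close> to be nonempty, so at most n - 1 rows
        carry a denominator.\<close>
      obtain z where "z \<in> Z" using Z unfolding reachable_from_all_def by blast
      then have "card (- Z) \<le> card (UNIV - {z})" by (intro card_mono) auto
      then show "card (- Z) \<le> CARD('n) - 1" by (simp add: card_Diff_singleton)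
      show "1 \<le> ?M"
        using row_denominator_pos[OF rat] row_denominator_le_matrix_denominator[OF rat]
        by (metis Suc_leI One_nat_def order_less_le_trans)
    qed
    finally show "(\<Prod>i\<in>UNIV. ?c i) \<le> ?M ^ (CARD('n) - 1)" .
  qed
  finally show ?thesis by simp
qed

section \<open>Hitting times and the Poisson equation\<close>

lemma expected_hitting_time:
  fixes P :: "real^'n^'n"
  assumes P: "stochastic P" and rat: "\<forall>i j. P $ i $ j \<in> \<rat>" and Z: "reachable_from_all P Z"
  obtains y where "\<And>i. i \<in> Z \<Longrightarrow> y $ i = 0" "\<And>i. i \<notin> Z \<Longrightarrow> y $ i = 1 + (P *v y) $ i"
    "\<And>i. y $ i \<le> real CARD('n) * real (denominator_bound P)"
proof -
  let ?A = "killed_laplacian P Z"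
  obtain G where G: "?A ** G = mat 1" "G ** ?A = mat 1"
    using killed_laplacian_inverse[OF P Z] by blast
  define b :: "real^'n" where "b = (\<chi> i. if i \<in> Z then 0 else 1)"
  define y where "y = G *v b"
  have "?A *v y = b" by (simp add: y_def matrix_vector_mul_assoc G)
  then have eq: "(if i \<in> Z then y $ i else y $ i - (P *v y) $ i) = b $ i" for i
    using killed_laplacian_mult by metis
  have det: "0 < det ?A" using det_killed_laplacian_bounds[OF P Z] by simp
  have "G $ i $ j \<le> real (denominator_bound P)" for i j
  proof -
    \<comment> \<open>The left side is the determinant after absorbing j as well.\<close>
    have "G $ j $ j * det ?A \<le> 1"
      using det_killed_laplacian_bounds[OF P reachable_from_all_mono[OF Z, of "insert j Z"]]
        det_killed_laplacian_insert[OF G(2), of j] by auto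
    then have "G $ j $ j \<le> 1 / det ?A" using det by (simp add: le_divide_eq)
    then show ?thesis
      using green_matrix_le_diag[OF P Z G(1), of i j]
        inverse_det_killed_laplacian_le[OF P rat Z] by linarith
  qed
  then have "y $ i \<le> (\<Sum>j\<in>(UNIV::'n set). real (denominator_bound P))" for i
    unfolding y_def matrix_vector_component
    by (intro sum_mono) (auto simp: b_def)
  then have "y $ i \<le> real CARD('n) * real (denominator_bound P)" for i
    by simp
  moreover have "y $ i = 0" if "i \<in> Z" for i using eq[of i] that by (simp add: b_def)
  moreover have "y $ i = 1 + (P *v y) $ i" if "i \<notin> Z" for i
    using eq[of i] that by (simp add: b_def)
  ultimately show ?thesis using that by blast
qed

text \<open>The hitting time \<open>y\<close> serves as a barrier: \<open>x - c *\<^sub>R y\<close>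
  is subharmonic off \<open>Z\<close> and equals \<open>x\<close> on \<open>Z\<close>.\<close>

lemma poisson_inequality:
  fixes P :: "real^'n^'n"
  assumes P: "stochastic P" and rat: "\<forall>i j. P $ i $ j \<in> \<rat>" and Z: "reachable_from_all P Z"
    and x: "\<And>k. k \<notin> Z \<Longrightarrow> x $ k - (P *v x) $ k \<le> c" and c: "0 \<le> c"
  shows "\<exists>z\<in>Z. x $ i \<le> c * real CARD('n) * real (denominator_bound P) + x $ z"
proof -
  obtain y where y: "\<And>i. i \<in> Z \<Longrightarrow> y $ i = 0" "\<And>i. i \<notin> Z \<Longrightarrow> y $ i = 1 + (P *v y) $ i"
      "\<And>i. y $ i \<le> real CARD('n) * real (denominator_bound P)"
    using expected_hitting_time[OF P rat Z] by blast
  have "\<exists>z\<in>Z. (x - c *\<^sub>R y) $ i \<le> (x - c *\<^sub>R y) $ z"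
  proof (rule maximum_principle[OF P Z])
    fix k assume "k \<notin> Z"
    then show "(x - c *\<^sub>R y) $ k \<le> (P *v (x - c *\<^sub>R y)) $ k"
      using x[of k] y(2)[of k]
      by (simp add: matrix_vector_mult_diff_distrib matrix_vector_mult_scaleR distrib_left)
  qed
  then obtain z where "z \<in> Z" "x $ i \<le> c * y $ i + x $ z" using y(1) by auto
  moreover have "c * y $ i \<le> c * (real CARD('n) * real (denominator_bound P))"
    using y(3) c by (intro mult_left_mono)
  ultimately show ?thesis by (force simp: mult.assoc)
qed

text \<open>The set where \<open>g\<close> is maximal is closed under \<open>P\<close>; evaluate the equation for \<open>u\<close> at a
  maximum of \<open>u\<close> on that set.\<close>

lemma gain_le:
  fixes P :: "real^'n^'n"
  assumes P: "stochastic P" and g: "P *v g = g" and u: "P *v u = g + u - r"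
    and r: "\<And>i. r $ i \<le> c"
  shows "g $ i \<le> c"
proof -
  obtain m where m: "\<And>l. g $ l \<le> g $ m" using vec_attains_max[of UNIV g] by auto
  define T where "T = {k. g $ k = g $ m}"
  have closed: "l \<in> T" if "k \<in> T" "0 < P $ k $ l" for k l
    using stochastic_mean_eq_max[OF P m, of k l] that g by (simp add: T_def)
  obtain k where k: "k \<in> T" "\<And>l. l \<in> T \<Longrightarrow> u $ l \<le> u $ k"
    using vec_attains_max[of T u] unfolding T_def by blast
  have "(P *v u) $ k \<le> u $ k"
    using stochastic_mean_le[OF P] closed k by blast
  then have "g $ k \<le> c" using u r[of k] by simp
  then show ?thesis using m[of i] k(1) by (simp add: T_def)
qed

section \<open>Essential states\<close>

text \<open>A purely graph-theoretic counterpart of recurrence: a state is essential when its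
  communicating class cannot be left.\<close>

definition essential_state :: "real^'n^'n \<Rightarrow> 'n \<Rightarrow> bool" where
  "essential_state P j \<longleftrightarrow> (\<forall>k. (j, k) \<in> accessible P \<longrightarrow> (k, j) \<in> accessible P)"

lemma accessible_refl [simp]: "(i, i) \<in> accessible P"
  by (simp add: accessible_def)

lemma accessible_trans: "(i, j) \<in> accessible P \<Longrightarrow> (j, k) \<in> accessible P \<Longrightarrow> (i, k) \<in> accessible P"
  unfolding accessible_def by (rule rtrancl_trans)

lemma accessible_step: "0 < P $ i $ j \<Longrightarrow> (i, j) \<in> accessible P"
  by (auto simp: accessible_def)

text \<open>Among the states accessible from i, take j with the fewest accessible states. Any k
  accessible from j reaches a subset of these, of no smaller size, hence all of them, including
  j.\<close>

lemma essential_state_reachable: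
  fixes P :: "real^'n^'n"
  shows "\<exists>j. (i, j) \<in> accessible P \<and> essential_state P j"
proof -
  let ?R = "\<lambda>j. {k. (j, k) \<in> accessible P}"
  obtain j where j: "(i, j) \<in> accessible P"
      and min: "\<And>k. (i, k) \<in> accessible P \<Longrightarrow> card (?R j) \<le> card (?R k)"
    using ex_has_least_nat[of "\<lambda>j. (i, j) \<in> accessible P" i "\<lambda>j. card (?R j)"] by auto
  have "(k, j) \<in> accessible P" if k: "(j, k) \<in> accessible P" for k
  proof -
    have "?R k \<subseteq> ?R j" using k accessible_trans by blast
    moreover have "card (?R j) \<le> card (?R k)" using min accessible_trans[OF j k] .
    ultimately have "?R k = ?R j" by (intro card_seteq) simp_all
    then show ?thesis by auto
  qed
  then show ?thesis using j unfolding essential_state_def by blast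
qed

lemma communicating_class_essential:
  "essential_state P j \<Longrightarrow> communicating_class P j = {k. (j, k) \<in> accessible P}"
  by (auto simp: communicating_class_def essential_state_def)

lemma essential_class_closed:
  assumes "essential_state P j" "k \<in> communicating_class P j" "0 < P $ k $ l"
  shows "l \<in> communicating_class P j"
  using assms accessible_trans[OF _ accessible_step, of j k P l] by (simp add: communicating_class_essential)

lemma essential_state_communicating:
  assumes "essential_state P j" "k \<in> communicating_class P j"
  shows "essential_state P k"
  unfolding essential_state_def
proof (intro allI impI)
  fix l assume "(k, l) \<in> accessible P"
  moreover have jk: "(j, k) \<in> accessible P"
    using assms(2) by (simp add: communicating_class_def)
  ultimately have "(l, j) \<in> accessible P"
    using assms(1) accessible_trans unfolding essential_state_def by metis
  then show "(l, k) \<in> accessible P" using jk by (rule accessible_trans)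
qed

text \<open>Absorbing everything outside a closed class confines the maximum principle to that
  class.\<close>

lemma class_complement_reachable:
  assumes "essential_state P j" "z \<in> communicating_class P j"
  shows "reachable_from_all P (insert z (- communicating_class P j))"
  unfolding reachable_from_all_def
proof
  fix i
  show "\<exists>z'\<in>insert z (- communicating_class P j). (i, z') \<in> accessible P"
  proof (cases "i \<in> communicating_class P j")
    case True
    then have "(i, z) \<in> accessible P"
      using assms(2) accessible_trans[of i j P z] by (simp add: communicating_class_def)
    then show ?thesis by blast
  qed (use accessible_refl in blast)
qed

lemma matrix_vector_mult_cong_support:
  assumes P: "stochastic P" and "\<And>l. 0 < P $ k $ l \<Longrightarrow> x $ l = y $ l"
  shows "(P *v x) $ k = (P *v y) $ k"
  unfolding matrix_vector_component
proof (rule sum.cong)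
  fix l
  show "P $ k $ l * x $ l = P $ k $ l * y $ l"
    using assms(2)[of l] stochastic_nonneg[OF P, of k l] by (cases "P $ k $ l = 0") auto
qed simp

section \<open>Recurrence of essential states\<close>

lemma first_passage_nonneg: "stochastic P \<Longrightarrow> 0 \<le> first_passage P j k i"
  by (induction k arbitrary: i) (auto intro!: sum_nonneg mult_nonneg_nonneg stochastic_nonneg)

text \<open>First-step analysis of the probability of visiting j at one of the times 1, ..., K +
  1.\<close>

lemma first_passage_partial_sum_Suc:
  "(\<Sum>k<Suc K. first_passage P j k i) =
    P $ i $ j + (\<Sum>l\<in>UNIV - {j}. P $ i $ l * (\<Sum>k<K. first_passage P j k l))"
proof -
  have "(\<Sum>k<K. \<Sum>l\<in>UNIV - {j}. P $ i $ l * first_passage P j k l)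
      = (\<Sum>l\<in>UNIV - {j}. P $ i $ l * (\<Sum>k<K. first_passage P j k l))"
    by (subst sum.swap) (simp add: sum_distrib_left)
  then show ?thesis by (simp add: sum.lessThan_Suc_shift del: sum.lessThan_Suc)
qed

lemma stochastic_row_split:
  "stochastic P \<Longrightarrow> P $ i $ j + (\<Sum>l\<in>UNIV - {j}. P $ i $ l) = 1"
  using stochastic_row_sum[of P i] by (simp add: sum.remove[of UNIV j])

lemma first_passage_partial_sum_le_1:
  assumes P: "stochastic P"
  shows "(\<Sum>k<K. first_passage P j k i) \<le> 1"
proof (induction K arbitrary: i)
  case (Suc K)
  have "(\<Sum>l\<in>UNIV - {j}. P $ i $ l * (\<Sum>k<K. first_passage P j k l))
      \<le> (\<Sum>l\<in>UNIV - {j}. P $ i $ l)"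
    using Suc stochastic_nonneg[OF P] by (intro sum_mono) (simp add: mult_left_le)
  then show ?case
    unfolding first_passage_partial_sum_Suc using stochastic_row_split[OF P, of i j] by linarith
qed simp

text \<open>The probability of never returning to \<open>j\<close> is harmonic on the closed class of \<open>j\<close> away from
  \<open>j\<close>; once set to \<open>0\<close> at \<open>j\<close> and off the class, it vanishes by the maximum principle.\<close>

lemma essential_state_recurrent:
  fixes P :: "real^'n^'n"
  assumes P: "stochastic P" and j: "essential_state P j"
  shows "recurrent_state P j"
proof -
  let ?f = "first_passage P j"
  define F where "F i = (\<Sum>k. ?f k i)" for i
  have sm: "summable (\<lambda>k. ?f k i)" for i
    using first_passage_nonneg[OF P] first_passage_partial_sum_le_1[OF P]
    by (rule summableI_nonneg_bounded)
  have lim: "(\<lambda>K. \<Sum>k<K. ?f k i) \<longlonglongrightarrow> F i" for i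
    unfolding F_def using sm by (rule summable_LIMSEQ)
  have F: "F i = P $ i $ j + (\<Sum>l\<in>UNIV - {j}. P $ i $ l * F l)" for i
  proof (rule LIMSEQ_unique)
    show "(\<lambda>K. \<Sum>k<Suc K. ?f k i) \<longlonglongrightarrow> F i" using lim by (rule LIMSEQ_Suc)
    show "(\<lambda>K. \<Sum>k<Suc K. ?f k i) \<longlonglongrightarrow> P $ i $ j + (\<Sum>l\<in>UNIV - {j}. P $ i $ l * F l)"
      unfolding first_passage_partial_sum_Suc by (intro tendsto_intros lim)
  qed
  let ?C = "communicating_class P j"
  define h :: "real^'n" where "h = (\<chi> i. if i = j then 0 else 1 - F i)"
  define h' :: "real^'n" where "h' = (\<chi> i. if i \<in> ?C then h $ i else 0)"
  \<comment> \<open>This also holds at i = j: \<open>F j\<close> counts only visits at positive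
    times, whereas \<open>h\<close> is 0 at j because a step into j ends the wait.\<close>
  have h: "1 - F i = (P *v h) $ i" for i
  proof -
    have "(P *v h) $ i = (\<Sum>l\<in>UNIV - {j}. P $ i $ l * (1 - F l))"
      unfolding matrix_vector_component
      by (intro sum.mono_neutral_cong_right) (auto simp: h_def)
    also have "\<dots> = (\<Sum>l\<in>UNIV - {j}. P $ i $ l) - (\<Sum>l\<in>UNIV - {j}. P $ i $ l * F l)"
      by (simp add: right_diff_distrib sum_subtractf)
    finally show ?thesis using F[of i] stochastic_row_split[OF P, of i j] by linarith
  qed
  have Ph: "(P *v h') $ k = (P *v h) $ k" if "k \<in> ?C" for k
    using essential_class_closed[OF j that]
    by (intro matrix_vector_mult_cong_support[OF P]) (simp add: h'_def)
  have jC: "j \<in> ?C" by (simp add: communicating_class_def)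
  have "h' $ i \<le> 0" for i
  proof -
    have "\<exists>z\<in>insert j (- ?C). h' $ i \<le> h' $ z"
    proof (rule maximum_principle[OF P class_complement_reachable[OF j jC]])
      fix k assume "k \<notin> insert j (- ?C)"
      then show "h' $ k \<le> (P *v h') $ k"
        using Ph[of k] h[of k] by (simp add: h'_def h_def)
    qed
    then show ?thesis by (auto simp: h'_def h_def split: if_splits)
  qed
  then have "(P *v h') $ j \<le> 0" by (intro stochastic_mean_le[OF P])
  then have "1 \<le> F j" using h[of j] Ph[OF jC] by simp
  moreover have "F j \<le> 1"
    using first_passage_partial_sum_le_1[OF P] by (intro LIMSEQ_le_const2[OF lim]) blast
  ultimately show ?thesis
    using summable_sums[OF sm[of j]] by (simp add: recurrent_state_def F_def)
qed

text \<open>This makes the hypotheses on recurrent classes available at every essential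
  state.\<close>

lemma essential_class_recurrent:
  assumes "stochastic P" "essential_state P j"
  shows "communicating_class P j \<in> recurrent_classes P"
  using essential_state_recurrent[OF assms(1) essential_state_communicating[OF assms(2)]]
  unfolding recurrent_classes_def by blast

section \<open>Bounds on bias vectors\<close>

lemma infnorm_le_cart:
  fixes x :: "real^'n"
  assumes "\<And>i. \<bar>x $ i\<bar> \<le> c"
  shows "infnorm x \<le> c"
  unfolding infnorm_cart using assms by (intro cSup_least) auto

text \<open>The factor 2 arises because u - Pu = r - g, where both r and -g are at most
  \<open>infnorm r\<close>. Keeping \<open>x\<close> apart from \<open>u\<close> allows
  \<open>u\<close> to be altered outside a class.\<close>

lemma bias_le_boundary_value:
  fixes P :: "real^'n^'n"
  assumes P: "stochastic P" and rat: "\<forall>i j. P $ i $ j \<in> \<rat>" and Z: "reachable_from_all P Z"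
    and u: "bias_vector r P u" and x: "\<And>k. k \<notin> Z \<Longrightarrow> x $ k - (P *v x) $ k = u $ k - (P *v u) $ k"
  shows "\<exists>z\<in>Z. x $ i \<le> 2 * infnorm r * real CARD('n) * real (denominator_bound P) + x $ z"
proof (rule poisson_inequality[OF P rat Z])
  obtain g where g: "P *v g = g" and u: "P *v u = g + u - r"
    using u unfolding bias_vector_def by blast
  have r: "\<bar>r $ i\<bar> \<le> infnorm r" for i by (rule component_le_infnorm_cart)
  \<comment> \<open>Negating the data turns the upper bound on the gain into a lower one.\<close>
  have "(- g) $ k \<le> infnorm r" for k
  proof (rule gain_le[OF P, of _ "- u" "- r"])
    show "P *v (- g) = - g" "P *v (- u) = - g + - u - - r"
      using g u by (simp_all add: vec.neg)
    show "(- r) $ i \<le> infnorm r" for i using r[of i] by simp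
  qed
  then have g_ge: "- g $ k \<le> infnorm r" for k by simp
  show "x $ k - (P *v x) $ k \<le> 2 * infnorm r" if "k \<notin> Z" for k
  proof -
    have "x $ k - (P *v x) $ k = r $ k - g $ k" using x[OF that] by (simp add: u)
    then show ?thesis using r[of k] g_ge[of k] by linarith
  qed
  show "0 \<le> 2 * infnorm r" by (simp add: infnorm_pos_le)
qed

lemma bias_vector_uminus: "bias_vector r P u \<Longrightarrow> bias_vector (- r) P (- u)"
proof -
  assume "bias_vector r P u"
  then obtain g where g: "P *v g = g" "P *v u = g + u - r"
    unfolding bias_vector_def by blast
  then have "P *v (- g) = - g" "P *v (- u) = - g + - u - - r"
    by (simp_all add: vec.neg)
  then show ?thesis unfolding bias_vector_def by blast
qed

lemma bias_abs_le:
  fixes P :: "real^'n^'n"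
  assumes P: "stochastic P" and rat: "\<forall>i j. P $ i $ j \<in> \<rat>" and Z: "reachable_from_all P Z"
    and u: "bias_vector r P u" and c: "\<And>z. z \<in> Z \<Longrightarrow> \<bar>u $ z\<bar> \<le> c"
  shows "\<bar>u $ i\<bar> \<le> 2 * infnorm r * real CARD('n) * real (denominator_bound P) + c"
    (is "_ \<le> ?B + c")
proof -
  obtain z where "z \<in> Z" "u $ i \<le> ?B + u $ z"
    using bias_le_boundary_value[OF P rat Z u, of u i] by auto
  then have "u $ i \<le> ?B + c" using c[of z] by linarith
  moreover obtain z' where "z' \<in> Z" "(- u) $ i \<le> ?B + (- u) $ z'"
    using bias_le_boundary_value[OF P rat Z bias_vector_uminus[OF u], of "- u" i]
    by (auto simp: infnorm_neg)
  then have "- u $ i \<le> ?B + c" using c[of z'] by simp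
  ultimately show ?thesis by (simp add: abs_le_iff)
qed

lemma bias_oscillation_on_class:
  fixes P :: "real^'n^'n"
  assumes P: "stochastic P" and rat: "\<forall>i j. P $ i $ j \<in> \<rat>" and u: "bias_vector r P u"
    and z: "essential_state P z" and i: "i \<in> communicating_class P z"
  shows "u $ i \<le> 2 * infnorm r * real CARD('n) * real (denominator_bound P) + u $ z"
proof -
  let ?C = "communicating_class P z"
  have zC: "z \<in> ?C" by (simp add: communicating_class_def)
  \<comment> \<open>Freezing \<open>u\<close> at \<open>u $ z\<close> off the class gives every
    boundary value of \<open>x\<close> the value \<open>u $ z\<close>, and the rows of a closed
    class do not see the change.\<close>
  define x :: "real^'n" where "x = (\<chi> k. if k \<in> ?C then u $ k else u $ z)"
  have "\<exists>k\<in>insert z (- ?C).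
      x $ i \<le> 2 * infnorm r * real CARD('n) * real (denominator_bound P) + x $ k"
  proof (rule bias_le_boundary_value[OF P rat class_complement_reachable[OF z zC] u])
    fix k assume k: "k \<notin> insert z (- ?C)"
    then have "l \<in> ?C" if "0 < P $ k $ l" for l
      using essential_class_closed[OF z] that by blast
    then have "(P *v x) $ k = (P *v u) $ k"
      by (intro matrix_vector_mult_cong_support[OF P]) (simp add: x_def)
    then show "x $ k - (P *v x) $ k = u $ k - (P *v u) $ k"
      using k by (simp add: x_def)
  qed
  then show ?thesis using i by (auto simp: x_def split: if_splits)
qed

lemma mean_zero_imp_ge:
  fixes u d :: "real^'n"
  assumes "\<And>i. 0 \<le> d $ i" "\<And>i. i \<notin> C \<Longrightarrow> d $ i = 0" "(\<Sum>i\<in>UNIV. d $ i) = 1"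
    and "(\<Sum>i\<in>C. u $ i * d $ i) = 0" and "\<And>i. i \<in> C \<Longrightarrow> u $ i \<le> c"
  shows "0 \<le> c"
proof -
  have "(\<Sum>i\<in>C. u $ i * d $ i) \<le> (\<Sum>i\<in>C. c * d $ i)"
    using assms(1,5) by (intro sum_mono mult_right_mono)
  also have "\<dots> = c * (\<Sum>i\<in>C. d $ i)" by (simp add: sum_distrib_left)
  also have "(\<Sum>i\<in>C. d $ i) = (\<Sum>i\<in>UNIV. d $ i)"
    using assms(2) by (intro sum.mono_neutral_left) auto
  finally show ?thesis using assms(3,4) by simp
qed

theorem theorem1p5:
  fixes P :: "real^'n^'n" and r u :: "real^'n" and \<pi> :: "'n set \<Rightarrow> real^'n"
  assumes "stochastic P"
    and "\<forall>i j. P $ i $ j \<in> \<rat>"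
    and "\<forall>i. r $ i \<in> \<int>"
    and "bias_vector r P u"
    and "\<forall>C\<in>recurrent_classes P. stationary_distribution_on P C (\<pi> C)"
  shows "((\<forall>C\<in>recurrent_classes P. \<exists>i\<in>C. u $ i = 0) \<longrightarrow>
           infnorm u \<le> 2 * infnorm r * real CARD('n) *
             real (min (\<Prod>i\<in>UNIV. row_denominator P i)
                       (matrix_denominator P ^ (CARD('n) - 1))))
       \<and> ((\<forall>C\<in>recurrent_classes P. (\<Sum>i\<in>C. u $ i * \<pi> C $ i) = 0) \<longrightarrow>
           infnorm u \<le> 4 * infnorm r * real CARD('n) *
             real (min (\<Prod>i\<in>UNIV. row_denominator P i)
                       (matrix_denominator P ^ (CARD('n) - 1))))"
proof -
  let ?B = "2 * infnorm r * real CARD('n) * real (denominator_bound P)"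
  note P = assms(1) and rat = assms(2) and u = assms(4)
  show ?thesis
  proof (intro conjI impI)
    assume zero: "\<forall>C\<in>recurrent_classes P. \<exists>i\<in>C. u $ i = 0"
    \<comment> \<open>From i the chain can reach an essential state; its class is recurrent, so it
      contains a zero of \<open>u\<close>, accessible from all of the class.\<close>
    have "\<exists>z\<in>{z. u $ z = 0}. (i, z) \<in> accessible P" for i
    proof -
      obtain j where j: "(i, j) \<in> accessible P" "essential_state P j"
        using essential_state_reachable by blast
      then obtain z where z: "z \<in> communicating_class P j" "u $ z = 0"
        using zero essential_class_recurrent[OF P] by blast
      then have "(i, z) \<in> accessible P"
        using accessible_trans[OF j(1)] by (simp add: communicating_class_def)
      then show ?thesis using z by blast
    qed
    then have "reachable_from_all P {z. u $ z = 0}"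
      unfolding reachable_from_all_def by blast
    then have "\<bar>u $ i\<bar> \<le> ?B + 0" for i
      by (rule bias_abs_le[OF P rat _ u]) simp
    then have "infnorm u \<le> ?B" by (intro infnorm_le_cart) simp
    then show "infnorm u \<le> 2 * infnorm r * real CARD('n) *
        real (min (\<Prod>i\<in>UNIV. row_denominator P i) (matrix_denominator P ^ (CARD('n) - 1)))"
      unfolding denominator_bound_def .
  next
    assume mean: "\<forall>C\<in>recurrent_classes P. (\<Sum>i\<in>C. u $ i * \<pi> C $ i) = 0"
    have "\<bar>u $ z\<bar> \<le> ?B" if z: "essential_state P z" for z
    proof -
      let ?C = "communicating_class P z"
      have C: "?C \<in> recurrent_classes P" using essential_class_recurrent[OF P z] .
      then have d: "\<And>i. 0 \<le> \<pi> ?C $ i" "\<And>i. i \<notin> ?C \<Longrightarrow> \<pi> ?C $ i = 0"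
          "(\<Sum>i\<in>UNIV. \<pi> ?C $ i) = 1"
        using assms(5) unfolding stationary_distribution_on_def by blast+
      have mean_C: "(\<Sum>i\<in>?C. u $ i * \<pi> ?C $ i) = 0" using mean C by blast
      \<comment> \<open>On the class of z, \<open>u\<close> is at most \<open>?B + u $ z\<close>, so
        its mean 0 is too. The same argument for \<open>- u\<close> gives the other sign.\<close>
      have "0 \<le> ?B + u $ z"
        by (rule mean_zero_imp_ge[OF d mean_C]) (assumption, rule bias_oscillation_on_class[OF P rat u z])
      moreover have neg_mean_C: "(\<Sum>i\<in>?C. (- u) $ i * \<pi> ?C $ i) = 0"
        using mean_C by (simp add: sum_negf)
      have "0 \<le> ?B + (- u) $ z"
        by (rule mean_zero_imp_ge[OF d neg_mean_C])
          (assumption, rule bias_oscillation_on_class[OF P rat bias_vector_uminus[OF u] z,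
            unfolded infnorm_neg])
      ultimately show ?thesis by (simp add: abs_le_iff)
    qed
    moreover have "reachable_from_all P {z. essential_state P z}"
      using essential_state_reachable unfolding reachable_from_all_def by blast
    \<comment> \<open>One \<open>?B\<close> bounds \<open>u\<close> on the essential states, the
      other extends the bound to the remaining states; hence the constant 4.\<close>
    ultimately have "\<bar>u $ i\<bar> \<le> ?B + ?B" for i
      by (intro bias_abs_le[OF P rat _ u]) auto
    then have "infnorm u \<le> ?B + ?B" by (rule infnorm_le_cart)
    then show "infnorm u \<le> 4 * infnorm r * real CARD('n) *
        real (min (\<Prod>i\<in>UNIV. row_denominator P i) (matrix_denominator P ^ (CARD('n) - 1)))"
      unfolding denominator_bound_def[symmetric] by simp
  qed
qed

end
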